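(* There is an absolute constant $K>0$ such that the following holds. Let $p\in[2,+\infty)$, $\alpha_p>0$, $q_p\in[2,+\infty)$, $\epsilon>0$, let $\mathcal{C}\subset\mathbb{R}^n$ be a nonempty compact convex set that is $(\alpha_p,q_p)$-uniformly convex with respect to the $\ell_p$-norm, let $x^*\in\mathcal{C}$, let $D_p=\max_{x,y\in\mathcal{C}}\|y-x\|_p$, and let $f(x)=\frac12\|x-x^*\|_p^2$ for $x\in\mathbb{R}^n$. Run the Frank-Wolfe algorithm on $\min_{x\in\mathcal{C}}f(x)$, started at an arbitrary vertex of $\mathcal{C}$, with the closed-loop step-size strategy. Then the algorithm produces an iterate $x\in\mathcal{C}$ satisfying $\|x-x^*\|_p\leq\epsilon$ whose cardinality is $\mathcal{O}(B)$, i.e. at most $K\max\{1,B\}$, where $$B=\frac{(pD_p^2)^{(q_p-1)/q_p}+p/\alpha_p^{2/q_p}}{\epsilon^{2(q_p-1)/q_p}}.$$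
   Context: $\|\cdot\|_p$ is the $\ell_p$-norm on $\mathbb{R}^n$ and $\langle\cdot,\cdot\rangle$ the Euclidean inner product. Vertices of $\mathcal{C}$ are its extreme points. A set $\mathcal{C}$ is $(\alpha,q)$-uniformly convex with respect to a norm $\|\cdot\|$ if $\alpha,q>0$ and for all $x,y\in\mathcal{C}$, $\gamma\in[0,1]$, and $z\in\mathbb{R}^n$ with $\|z\|=1$, we have $(1-\gamma)x+\gamma y+(1-\gamma)\gamma\alpha\|x-y\|^qz\in\mathcal{C}$. Frank-Wolfe algorithm (FW) for a differentiable function $f$ over $\mathcal{C}$: start at a vertex $x_0$ of $\mathcal{C}$; for $t=0,1,2,\ldots$ let $v_t$ be a vertex of $\mathcal{C}$ belonging to $\arg\min_{v\in\mathcal{C}}\langle v,\nabla f(x_t)\rangle$, and set $x_{t+1}=x_t+\gamma_t(v_t-x_t)$ with $\gamma_t\in[0,1]$. Here $f$ is differentiable, $\nabla f(x^* )=0$, and for $x\neq x^*$ the $i$-th entry of $\nabla f(x)$ is $\|x-x^*\|_p^{2-p}\operatorname{sign}([x-x^*]_i)|[x-x^*]_i|^{p-1}$. Closed-loop strategy: $\gamma_t=\min\left\{\frac{\langle x_t-v_t,\nabla f(x_t)\rangle}{(p-1)\|x_t-v_t\|_p^2},1\right\}$ (if $v_t=x_t$, the value of $\gamma_t$ is irrelevant). Each iterate $x_{t+1}=(1-\gamma_t)x_t+\gamma_tv_t$ comes with an explicit convex decomposition over $x_0,v_0,\ldots,v_t$. The cardinality of an iterate is the number of distinct vertices with positive weight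 in this decomposition. *)

theory Defs
  imports "HOL-Analysis.Analysis" "HOL-Library.Function_Algebras"
begin

text \<open>
  The constant in the theorem must not depend on the dimension, so the dimension has to be quantified
  inside the statement and cannot be a type. The space \<open>\<real>\<^sup>n\<close> is therefore the set
  \<open>topspace (Euclidean_space n)\<close> of all functions \<open>x :: nat \<Rightarrow> real\<close> with \<open>x i = 0\<close> for
  \<open>i \<ge> n\<close>; the topology of \<open>Euclidean_space n\<close> is the usual one of \<open>\<real>\<^sup>n\<close>.
  The pointwise vector space structure on functions makes the library notions \<open>convex\<close> and
  \<open>extreme_point_of\<close> available.
\<close>

instantiation "fun" :: (type, real_vector) real_vector
begin

definition scaleR_fun_def: "c *\<^sub>R f = (\<lambda>x. c *\<^sub>R f x)"

instance
  by standard (simp_all add: scaleR_fun_def fun_eq_iff scaleR_add_right scaleR_add_left)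

end

lemma scaleR_fun_apply [simp]: "(c *\<^sub>R f) x = c *\<^sub>R f x"
  by (simp add: scaleR_fun_def)

definition inner_n :: "nat \<Rightarrow> (nat \<Rightarrow> real) \<Rightarrow> (nat \<Rightarrow> real) \<Rightarrow> real" where
  "inner_n n x y = (\<Sum>i<n. x i * y i)"

definition lp_norm :: "nat \<Rightarrow> real \<Rightarrow> (nat \<Rightarrow> real) \<Rightarrow> real" where
  "lp_norm n p x = (\<Sum>i<n. \<bar>x i\<bar> powr p) powr (1 / p)"

text \<open>For a nonempty compact \<open>C\<close> (and \<open>p \<ge> 1\<close>) the supremum is attained, so it is the maximum.\<close>

definition lp_diameter :: "nat \<Rightarrow> real \<Rightarrow> (nat \<Rightarrow> real) set \<Rightarrow> real" where
  "lp_diameter n p C = (SUP (x, y)\<in>C \<times> C. lp_norm n p (y - x))"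

definition uniformly_convex ::
  "nat \<Rightarrow> ((nat \<Rightarrow> real) \<Rightarrow> real) \<Rightarrow> real \<Rightarrow> real \<Rightarrow> (nat \<Rightarrow> real) set \<Rightarrow> bool" where
  "uniformly_convex n N \<alpha> q C \<longleftrightarrow> \<alpha> > 0 \<and> q > 0 \<and>
     (\<forall>x\<in>C. \<forall>y\<in>C. \<forall>\<gamma>\<in>{0..1}. \<forall>z\<in>topspace (Euclidean_space n). N z = 1 \<longrightarrow>
        (1 - \<gamma>) *\<^sub>R x + \<gamma> *\<^sub>R y + ((1 - \<gamma>) * \<gamma> * \<alpha> * N (x - y) powr q) *\<^sub>R z \<in> C)"

text \<open>The vector of partial derivatives; meaningful for differentiable \<open>f\<close>.\<close>

definition gradient :: "nat \<Rightarrow> ((nat \<Rightarrow> real) \<Rightarrow> real) \<Rightarrow> (nat \<Rightarrow> real) \<Rightarrow> nat \<Rightarrow> real" where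
  "gradient n f x = (\<lambda>i. if i < n then deriv (\<lambda>s. f (x(i := s))) (x i) else 0)"

definition half_sq_dist :: "nat \<Rightarrow> real \<Rightarrow> (nat \<Rightarrow> real) \<Rightarrow> (nat \<Rightarrow> real) \<Rightarrow> real" where
  "half_sq_dist n p xstar x = (lp_norm n p (x - xstar))\<^sup>2 / 2"

text \<open>
  A run is any triple of sequences the algorithm may produce: the choice of the start vertex, of the
  minimizing vertices, and of the step sizes is only restricted by the conditions below.
\<close>

definition frank_wolfe_run ::
  "nat \<Rightarrow> (nat \<Rightarrow> real) set \<Rightarrow> ((nat \<Rightarrow> real) \<Rightarrow> real) \<Rightarrow>
   (nat \<Rightarrow> nat \<Rightarrow> real) \<Rightarrow> (nat \<Rightarrow> nat \<Rightarrow> real) \<Rightarrow> (nat \<Rightarrow> real) \<Rightarrow> bool" where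
  "frank_wolfe_run n C f x v \<gamma> \<longleftrightarrow>
     x 0 extreme_point_of C \<and>
     (\<forall>t. v t extreme_point_of C \<and>
          is_arg_min (\<lambda>u. inner_n n u (gradient n f (x t))) (\<lambda>u. u \<in> C) (v t) \<and>
          \<gamma> t \<in> {0..1} \<and>
          x (Suc t) = x t + \<gamma> t *\<^sub>R (v t - x t))"

definition closed_loop ::
  "nat \<Rightarrow> real \<Rightarrow> ((nat \<Rightarrow> real) \<Rightarrow> real) \<Rightarrow>
   (nat \<Rightarrow> nat \<Rightarrow> real) \<Rightarrow> (nat \<Rightarrow> nat \<Rightarrow> real) \<Rightarrow> (nat \<Rightarrow> real) \<Rightarrow> bool" where
  "closed_loop n p f x v \<gamma> \<longleftrightarrow>
     (\<forall>t. v t \<noteq> x t \<longrightarrow>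
        \<gamma> t = min (inner_n n (x t - v t) (gradient n f (x t)) /
                   ((p - 1) * (lp_norm n p (x t - v t))\<^sup>2)) 1)"

text \<open>
  \<open>fw_weight x0 v \<gamma> t u\<close> is the weight of the vertex \<open>u\<close> in the convex decomposition of \<open>x t\<close> over
  \<open>x0, v 0, \<dots>, v (t - 1)\<close> obtained by unfolding \<open>x (t + 1) = (1 - \<gamma> t) x t + \<gamma> t v t\<close>; repeated
  occurrences of a vertex are merged by adding up their weights.
\<close>

primrec fw_weight :: "'a \<Rightarrow> (nat \<Rightarrow> 'a) \<Rightarrow> (nat \<Rightarrow> real) \<Rightarrow> nat \<Rightarrow> 'a \<Rightarrow> real" where
  "fw_weight x0 v \<gamma> 0 = (\<lambda>u. of_bool (u = x0))"
| "fw_weight x0 v \<gamma> (Suc t) =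
     (\<lambda>u. (1 - \<gamma> t) * fw_weight x0 v \<gamma> t u + \<gamma> t * of_bool (u = v t))"

definition fw_cardinality :: "'a \<Rightarrow> (nat \<Rightarrow> 'a) \<Rightarrow> (nat \<Rightarrow> real) \<Rightarrow> nat \<Rightarrow> nat" where
  "fw_cardinality x0 v \<gamma> t = card {u. fw_weight x0 v \<gamma> t u > 0}"

text \<open>
  The function \<open>half_sq_dist n p xstar\<close> has all partial derivatives (so \<open>deriv\<close> above is not a junk
  value), and they are given by the expected formula.
\<close>

lemma has_real_derivative_abs_powr:
  fixes p u :: real
  assumes "p > 1"
  shows "((\<lambda>s. \<bar>s\<bar> powr p) has_real_derivative p * sgn u * \<bar>u\<bar> powr (p - 1)) (at u)"
proof (cases "u = 0")
  case True
  have "((\<lambda>h. sgn h * \<bar>h\<bar> powr (p - 1)) \<longlongrightarrow> 0) (at (0::real))"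
  proof (rule Lim_null_comparison)
    show "\<forall>\<^sub>F h in at (0::real). norm (sgn h * \<bar>h\<bar> powr (p - 1)) \<le> \<bar>h\<bar> powr (p - 1)"
      by (simp add: abs_mult abs_sgn_eq)
    have "((\<lambda>h::real. \<bar>h\<bar> powr (p - 1)) \<longlongrightarrow> \<bar>0\<bar> powr (p - 1)) (at 0)"
      using assms by (intro tendsto_powr2 tendsto_intros) (auto simp: eventually_at)
    then show "((\<lambda>h::real. \<bar>h\<bar> powr (p - 1)) \<longlongrightarrow> 0) (at 0)"
      by simp
  qed
  moreover have "\<bar>h\<bar> powr p / h = sgn h * \<bar>h\<bar> powr (p - 1)" if "h \<noteq> 0" for h :: real
    using that by (simp add: powr_diff sgn_if field_simps)
  ultimately have "((\<lambda>h. \<bar>h\<bar> powr p / h) \<longlongrightarrow> 0) (at (0::real))"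
    by (subst Lim_cong_within[OF refl refl refl]) auto
  then show ?thesis
    using True by (simp add: DERIV_def)
next
  case False
  have "((\<lambda>s. \<bar>s\<bar>) has_real_derivative sgn u) (at u)"
  proof (rule DERIV_cong[OF has_field_derivative_transform_within_open[of "\<lambda>s. sgn u * s" "sgn u" u
        "if u > 0 then {0<..} else {..<0}"]])
    show "((\<lambda>s. sgn u * s) has_real_derivative sgn u) (at u)"
      by (auto intro!: derivative_eq_intros)
  qed (use False in \<open>auto simp: sgn_if split: if_splits\<close>)
  from DERIV_fun_powr[OF this, of p] False show ?thesis
    by (simp add: algebra_simps)
qed

lemma half_sq_dist_partial:
  assumes p: "p \<ge> 2" and x: "x \<in> topspace (Euclidean_space n)"
    and xs: "xstar \<in> topspace (Euclidean_space n)" and i: "i < n"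
  defines "d \<equiv> x - xstar"
  shows "((\<lambda>s. half_sq_dist n p xstar (x(i := s))) has_real_derivative
           (if x = xstar then 0
            else lp_norm n p d powr (2 - p) * sgn (d i) * \<bar>d i\<bar> powr (p - 1))) (at (x i))"
proof -
  define c where "c = (\<Sum>j\<in>{..<n} - {i}. \<bar>d j\<bar> powr p)"
  have split: "(\<Sum>j<n. \<bar>(x(i := s) - xstar) j\<bar> powr p) = \<bar>s - xstar i\<bar> powr p + c" for s
  proof -
    have "(\<Sum>j<n. \<bar>(x(i := s) - xstar) j\<bar> powr p) = \<bar>(x(i := s) - xstar) i\<bar> powr p
        + (\<Sum>j\<in>{..<n} - {i}. \<bar>(x(i := s) - xstar) j\<bar> powr p)"
      using i by (subst sum.remove[of _ i]) auto
    also have "(\<Sum>j\<in>{..<n} - {i}. \<bar>(x(i := s) - xstar) j\<bar> powr p) = c"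
      unfolding c_def d_def by (intro sum.cong) auto
    finally show ?thesis by simp
  qed
  have sq: "(a powr (1 / p))\<^sup>2 = a powr (2 / p)" for a :: real
    using p by (simp add: power2_eq_square powr_add[symmetric])
  have f: "half_sq_dist n p xstar (x(i := s)) = (\<bar>s - xstar i\<bar> powr p + c) powr (2 / p) / 2" for s
    unfolding half_sq_dist_def lp_norm_def sq split ..
  show ?thesis
  proof (cases "x = xstar")
    case True
    then have "c = 0" using p by (simp add: c_def d_def)
    then have eq: "half_sq_dist n p xstar (x(i := s)) = (s - xstar i)\<^sup>2 / 2" for s
      using p by (simp add: f powr_powr)
    show ?thesis
      unfolding eq using True by (auto intro!: derivative_eq_intros)
  next
    case False
    then obtain j where j: "x j \<noteq> xstar j" unfolding fun_eq_iff by blast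
    have "x j = xstar j" if "j \<ge> n"
      using x xs that unfolding topspace_Euclidean_space by simp
    with j have jn: "j < n" using not_less by blast
    define S where "S = (\<Sum>j<n. \<bar>d j\<bar> powr p)"
    have S: "S = \<bar>x i - xstar i\<bar> powr p + c"
      using split[of "x i"] by (simp add: S_def d_def)
    have "S > 0"
      unfolding S_def using jn j by (intro sum_pos2[of _ j]) (auto simp: d_def)
    have "((\<lambda>s. s - xstar i) has_real_derivative 1) (at (x i))"
      by (auto intro!: derivative_eq_intros)
    from DERIV_chain2[OF has_real_derivative_abs_powr this, of p] p
    have "((\<lambda>s. \<bar>s - xstar i\<bar> powr p) has_real_derivative
            p * sgn (d i) * \<bar>d i\<bar> powr (p - 1)) (at (x i))"
      by (simp add: d_def)
    from DERIV_add[OF this DERIV_const[of c]]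
    have "((\<lambda>s. \<bar>s - xstar i\<bar> powr p + c) has_real_derivative
            p * sgn (d i) * \<bar>d i\<bar> powr (p - 1)) (at (x i))"
      by simp
    from DERIV_fun_powr[OF this, of "2 / p"] \<open>S > 0\<close>
    have "((\<lambda>s. (\<bar>s - xstar i\<bar> powr p + c) powr (2 / p)) has_real_derivative
            2 / p * S powr (2 / p - 1) * (p * sgn (d i) * \<bar>d i\<bar> powr (p - 1))) (at (x i))"
      unfolding S by simp
    from DERIV_cdivide[OF this, of 2]
    have "((\<lambda>s. (\<bar>s - xstar i\<bar> powr p + c) powr (2 / p) / 2) has_real_derivative
            S powr (2 / p - 1) * sgn (d i) * \<bar>d i\<bar> powr (p - 1)) (at (x i))"
      using p by (simp add: field_simps)
    moreover have "lp_norm n p d powr (2 - p) = S powr (2 / p - 1)"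
      using p by (simp add: lp_norm_def S_def powr_powr diff_divide_distrib)
    ultimately show ?thesis
      using False by (simp add: f)
  qed
qed

lemma gradient_half_sq_dist:
  assumes "p \<ge> 2" and "x \<in> topspace (Euclidean_space n)"
    and "xstar \<in> topspace (Euclidean_space n)" and "i < n"
  shows "gradient n (half_sq_dist n p xstar) x i =
     (if x = xstar then 0
      else lp_norm n p (x - xstar) powr (2 - p) * sgn (x i - xstar i)
             * \<bar>x i - xstar i\<bar> powr (p - 1))"
  using DERIV_imp_deriv[OF half_sq_dist_partial[OF assms]] assms(4)
  by (simp add: gradient_def)

end

theory Submission
  imports Defs
begin

text \<open>
  Write \<open>d = \<parallel>x - x\<^sup>*\<parallel>\<close>, let \<open>g = \<langle>x - v, \<nabla>f(x)\<rangle>\<close> be the Frank-Wolfe gap at an iterate \<open>x\<close> and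
  \<open>s = \<parallel>x - v\<parallel>\<close>, all norms being \<open>\<ell>\<^sub>p\<close>. Three facts are combined.

  \<^item> The function \<open>f\<close> is \<open>(p - 1)\<close>-smooth with respect to the \<open>\<ell>\<^sub>p\<close>-norm (\<open>lp_norm_sq_add_le\<close>), so
    a step of size \<open>\<gamma>\<close> changes \<open>d\<^sup>2\<close> by at most \<open>- 2 \<gamma> g + \<gamma>\<^sup>2 (p - 1) s\<^sup>2\<close>. The closed-loop step minimizes
    this expression over \<open>[0, 1]\<close>.
  \<^item> The identity \<open>\<langle>x - x\<^sup>*, \<nabla>f(x)\<rangle> = d\<^sup>2\<close> and the minimality of \<open>v\<close> give \<open>g \<ge> d\<^sup>2\<close>. This is twice what
    mere convexity gives, and it has a pleasant effect: when the step size is capped at \<open>1\<close>, the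
    next iterate is \<open>x\<^sup>*\<close> itself. Otherwise \<open>d\<^sup>2\<close> decreases by at least \<open>g\<^sup>2 / ((p - 1) s\<^sup>2)\<close>
    (\<open>short_step_decrease\<close>).
  \<^item> Uniform convexity puts the midpoint of \<open>x\<close> and \<open>v\<close>, pushed by \<open>(\<alpha>/4) s\<^sup>q\<close> in the direction
    \<open>- (x - x\<^sup>*) / d\<close>, into the feasible set. Comparing it with \<open>v\<close> gives \<open>g \<ge> (\<alpha>/2) s\<^sup>q d\<close>
    (\<open>uniformly_convex_gap\<close>), so that \<open>s\<close> can only be large if \<open>g\<close> is large too.

  Eliminating \<open>s\<close> and \<open>g\<close> gives, with \<open>b = (q - 1)/q\<close> and \<open>\<kappa> = (\<alpha>/2)\<^bsup>2/q\<^esup> / (p - 1)\<close>, the recursion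
  \<open>u' \<le> u - \<kappa> u\<^bsup>1 + b\<^esup>\<close> for \<open>u = d\<^sup>2\<close> (\<open>closed_loop_sq_dist_recursion\<close>). Hence \<open>u\<^bsup>-b\<^esup>\<close> grows by at
  least \<open>b \<kappa>\<close> per step, and \<open>u \<le> \<epsilon>\<^sup>2\<close> is reached after at most about
  \<open>1 / (b \<kappa> \<epsilon>\<^bsup>2b\<^esup>) \<le> 4 p / (\<alpha>\<^bsup>2/q\<^esup> \<epsilon>\<^bsup>2b\<^esup>)\<close> steps. Every step adds at most one vertex to the
  decomposition, so the number of steps also bounds the cardinality.
\<close>

section \<open>The \<open>\<ell>\<^sub>p\<close>-norm and its duality map\<close>

lemma lp_norm_nonneg: "0 \<le> lp_norm n p x"
  by (simp add: lp_norm_def)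

lemma lp_norm_powr:
  assumes "p > 0"
  shows "lp_norm n p x powr p = (\<Sum>i<n. \<bar>x i\<bar> powr p)"
  using assms by (simp add: lp_norm_def powr_powr sum_nonneg)

lemma lp_norm_sq: "(lp_norm n p x)\<^sup>2 = (\<Sum>i<n. \<bar>x i\<bar> powr p) powr (2 / p)"
  by (simp add: lp_norm_def power2_eq_square flip: powr_add)

lemma lp_norm_eq_0_iff: "lp_norm n p x = 0 \<longleftrightarrow> (\<forall>i<n. x i = 0)"
proof -
  have "lp_norm n p x = 0 \<longleftrightarrow> (\<forall>i\<in>{..<n}. \<bar>x i\<bar> powr p = 0)"
    unfolding lp_norm_def by (subst powr_eq_0_iff, subst sum_nonneg_eq_0_iff) auto
  then show ?thesis by auto
qed

lemma lp_norm_pos: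
  assumes "x \<in> topspace (Euclidean_space n)" "y \<in> topspace (Euclidean_space n)" "x \<noteq> y"
  shows "0 < lp_norm n p (x - y)"
proof -
  have "lp_norm n p (x - y) \<noteq> 0"
  proof
    assume "lp_norm n p (x - y) = 0"
    then have "x i = y i" for i
      using assms(1,2) unfolding lp_norm_eq_0_iff topspace_Euclidean_space
      by (cases "i < n") auto
    with assms(3) show False by auto
  qed
  with lp_norm_nonneg[of n p "x - y"] show ?thesis by linarith
qed

lemma lp_norm_cong: "(\<And>i. i < n \<Longrightarrow> \<bar>x i\<bar> = \<bar>y i\<bar>) \<Longrightarrow> lp_norm n p x = lp_norm n p y"
  by (simp add: lp_norm_def)

lemma lp_norm_scaleR:
  assumes "p > 0"
  shows "lp_norm n p (c *\<^sub>R x) = \<bar>c\<bar> * lp_norm n p x"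
proof -
  have "(\<Sum>i<n. \<bar>(c *\<^sub>R x) i\<bar> powr p) = \<bar>c\<bar> powr p * (\<Sum>i<n. \<bar>x i\<bar> powr p)"
    by (simp add: abs_mult powr_mult sum_distrib_left)
  then show ?thesis
    using assms by (simp add: lp_norm_def powr_mult powr_powr sum_nonneg)
qed

text \<open>
  The gradient of \<open>d \<mapsto> \<parallel>d\<parallel>\<^sub>p\<^sup>2 / 2\<close>. At \<open>d = 0\<close> the factor \<open>sgn (d i)\<close> makes it vanish, so that the
  formula covers the minimizer without a case distinction.
\<close>

definition duality_map :: "nat \<Rightarrow> real \<Rightarrow> (nat \<Rightarrow> real) \<Rightarrow> nat \<Rightarrow> real" where
  "duality_map n p d i = lp_norm n p d powr (2 - p) * sgn (d i) * \<bar>d i\<bar> powr (p - 1)"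

lemma inner_duality_map_self:
  assumes "p > 0"
  shows "inner_n n d (duality_map n p d) = (lp_norm n p d)\<^sup>2"
proof -
  have "d i * duality_map n p d i = lp_norm n p d powr (2 - p) * \<bar>d i\<bar> powr p" for i
    by (cases "d i = 0") (auto simp: duality_map_def powr_diff sgn_if)
  then have "inner_n n d (duality_map n p d) = lp_norm n p d powr (2 - p) * lp_norm n p d powr p"
    by (simp add: inner_n_def lp_norm_powr[OF assms] sum_distrib_left)
  also have "\<dots> = lp_norm n p d powr 2"
    by (simp flip: powr_add)
  also have "\<dots> = (lp_norm n p d)\<^sup>2"
    by (cases "lp_norm n p d = 0") (use lp_norm_nonneg[of n p d] in \<open>auto simp: powr_numeral\<close>)
  finally show ?thesis .
qed

lemma inner_n_scaleR_left: "inner_n n (c *\<^sub>R x) y = c * inner_n n x y"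
  by (simp add: inner_n_def sum_distrib_left mult.assoc)

lemma inner_n_add_left: "inner_n n (x + y) z = inner_n n x z + inner_n n y z"
  by (simp add: inner_n_def sum.distrib distrib_right)

lemma inner_n_diff_left: "inner_n n (x - y) z = inner_n n x z - inner_n n y z"
  by (simp add: inner_n_def sum_subtractf left_diff_distrib)

lemma inner_n_cong_left: "(\<And>i. i < n \<Longrightarrow> x i = y i) \<Longrightarrow> inner_n n x z = inner_n n y z"
  by (simp add: inner_n_def)

section \<open>Smoothness of the squared \<open>\<ell>\<^sub>p\<close>-norm\<close>

text \<open>
  After dividing \<open>a\<close> and \<open>b\<close> by their sums, the summands are bounded by Young's inequality and the
  bounds add up to \<open>s + t = 1\<close>.
\<close>

lemma Hoelder_sum_powr:
  fixes a b :: "'a \<Rightarrow> real"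
  assumes "finite I" and nn: "\<And>i. i \<in> I \<Longrightarrow> 0 \<le> a i" "\<And>i. i \<in> I \<Longrightarrow> 0 \<le> b i"
    and w: "0 \<le> s" "0 \<le> t" "s + t = 1"
  shows "(\<Sum>i\<in>I. a i powr s * b i powr t) \<le> (\<Sum>i\<in>I. a i) powr s * (\<Sum>i\<in>I. b i) powr t"
proof -
  define A where "A = (\<Sum>i\<in>I. a i)"
  define B where "B = (\<Sum>i\<in>I. b i)"
  have AB: "0 \<le> A" "0 \<le> B" unfolding A_def B_def using nn by (auto intro: sum_nonneg)
  show ?thesis
  proof (cases "A = 0 \<or> B = 0")
    case True
    then have "a i powr s * b i powr t = 0" if "i \<in> I" for i
      using that assms(1) nn by (auto simp: A_def B_def sum_nonneg_eq_0_iff)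
    then have "(\<Sum>i\<in>I. a i powr s * b i powr t) = 0" by (rule sum.neutral[OF ballI])
    with AB show ?thesis by simp
  next
    case False
    then have pos: "0 < A" "0 < B" using AB by auto
    have summand: "a i powr s * b i powr t \<le> A powr s * B powr t * (s * (a i / A) + t * (b i / B))"
      if "i \<in> I" for i
    proof (cases "a i = 0 \<or> b i = 0")
      case True
      then have "a i powr s * b i powr t = 0" by auto
      also have "0 \<le> A powr s * B powr t * (s * (a i / A) + t * (b i / B))"
        using nn[OF that] pos w by (intro mult_nonneg_nonneg add_nonneg_nonneg) auto
      finally show ?thesis .
    next
      case False
      then have "0 < a i" "0 < b i" using nn[OF that] by auto
      then have "(a i / A) powr s * (b i / B) powr t \<le> s * (a i / A) + t * (b i / B)"
        using pos w by (intro Youngs_inequality_0) auto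
      moreover have "(a i / A) powr s * (b i / B) powr t = a i powr s * b i powr t / (A powr s * B powr t)"
        using pos nn[OF that] by (simp add: powr_divide)
      ultimately show ?thesis
        using pos by (simp add: field_simps)
    qed
    have "(\<Sum>i\<in>I. a i powr s * b i powr t)
        \<le> (\<Sum>i\<in>I. A powr s * B powr t * (s * (a i / A) + t * (b i / B)))"
      by (intro sum_mono summand)
    also have "\<dots> = A powr s * B powr t * (s * (A / A) + t * (B / B))"
      unfolding A_def B_def
      by (simp only: sum.distrib flip: sum_distrib_left sum_divide_distrib)
    also have "\<dots> = A powr s * B powr t"
      using pos w by simp
    finally show ?thesis unfolding A_def B_def .
  qed
qed

text \<open>
  The derivative of \<open>\<bar>s\<bar>\<^sup>p / p\<close>, differentiated once more. At \<open>u = 0\<close> the formula needs \<open>r > 1\<close>: for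
  \<open>r = 1\<close> the derivative is \<open>1\<close>, but \<open>0 powr 0 = 0\<close>. This is why the case \<open>p = 2\<close> of the smoothness
  inequality is treated separately below.
\<close>

lemma has_real_derivative_sgn_abs_powr:
  fixes r u :: real
  assumes "r > 1"
  shows "((\<lambda>s. sgn s * \<bar>s\<bar> powr r) has_real_derivative r * \<bar>u\<bar> powr (r - 1)) (at u)"
proof (cases "u = 0")
  case True
  have "((\<lambda>h::real. \<bar>h\<bar> powr (r - 1)) \<longlongrightarrow> \<bar>0\<bar> powr (r - 1)) (at 0)"
    using assms by (intro tendsto_powr2 tendsto_intros) (auto simp: eventually_at)
  moreover have "sgn h * \<bar>h\<bar> powr r / h = \<bar>h\<bar> powr (r - 1)" if "h \<noteq> 0" for h :: real
    using that by (simp add: powr_diff sgn_if field_simps)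
  ultimately have "((\<lambda>h. sgn h * \<bar>h\<bar> powr r / h) \<longlongrightarrow> 0) (at (0::real))"
    by (subst Lim_cong_within[OF refl refl refl]) auto
  then show ?thesis
    using True assms by (simp add: DERIV_def)
next
  case False
  have "((\<lambda>s. sgn u * \<bar>s\<bar> powr r) has_real_derivative sgn u * (r * sgn u * \<bar>u\<bar> powr (r - 1))) (at u)"
    by (intro DERIV_cmult has_real_derivative_abs_powr assms)
  then have "((\<lambda>s. sgn s * \<bar>s\<bar> powr r) has_real_derivative sgn u * (r * sgn u * \<bar>u\<bar> powr (r - 1))) (at u)"
    by (rule has_field_derivative_transform_within_open[where S = "if u > 0 then {0<..} else {..<0}"])
      (use False in \<open>auto simp: sgn_if split: if_splits\<close>)
  moreover have "sgn u * (r * sgn u * \<bar>u\<bar> powr (r - 1)) = r * \<bar>u\<bar> powr (r - 1)"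
    using False by (simp add: sgn_if)
  ultimately show ?thesis by metis
qed

text \<open>
  Taylor's formula of order two for \<open>t \<mapsto> \<parallel>d + t y\<parallel>\<^sub>p\<^sup>2 = S(t)\<^bsup>2/p\<^esup>\<close>, where \<open>S\<close> is the sum of the \<open>p\<close>-th
  powers. In the second derivative the term with \<open>S'(t)\<^sup>2\<close> has the factor \<open>2/p - 1 \<le> 0\<close>, and Hoelder's
  inequality with exponents \<open>p/(p - 2)\<close> and \<open>p/2\<close> bounds the term with \<open>S''(t)\<close> by \<open>2 (p - 1) \<parallel>y\<parallel>\<^sub>p\<^sup>2\<close>.
  The segment has to avoid the origin because \<open>S\<^bsup>2/p\<^esup>\<close> is differentiated as a power of a positive
  function.
\<close>

lemma lp_norm_sq_add_le_segment:
  assumes p: "p > 2"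
    and nz: "\<And>t. 0 \<le> t \<Longrightarrow> t \<le> 1 \<Longrightarrow> \<exists>i<n. d i + t * y i \<noteq> 0"
  shows "(lp_norm n p (d + y))\<^sup>2
    \<le> (lp_norm n p d)\<^sup>2 + 2 * inner_n n y (duality_map n p d) + (p - 1) * (lp_norm n p y)\<^sup>2"
proof -
  define S where "S t = (\<Sum>i<n. \<bar>d i + t * y i\<bar> powr p)" for t
  define S1 where "S1 t = (\<Sum>i<n. p * (sgn (d i + t * y i) * \<bar>d i + t * y i\<bar> powr (p - 1)) * y i)" for t
  define S2 where "S2 t = (\<Sum>i<n. p * ((p - 1) * \<bar>d i + t * y i\<bar> powr (p - 2) * y i) * y i)" for t
  have Spos: "0 < S t" if t: "0 \<le> t" "t \<le> 1" for t
  proof -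
    obtain i where "i < n" "d i + t * y i \<noteq> 0" using nz[OF t] by blast
    then show ?thesis unfolding S_def by (intro sum_pos2[of _ i]) auto
  qed
  have lin: "((\<lambda>t. d i + t * y i) has_real_derivative y i) (at t)" for i t
    by (auto intro!: derivative_eq_intros)
  have S: "(S has_real_derivative S1 t) (at t)" for t
    unfolding S_def[abs_def] S1_def
  proof (rule DERIV_sum)
    fix i
    show "((\<lambda>t. \<bar>d i + t * y i\<bar> powr p) has_real_derivative
        p * (sgn (d i + t * y i) * \<bar>d i + t * y i\<bar> powr (p - 1)) * y i) (at t)"
      using DERIV_chain2[OF has_real_derivative_abs_powr lin, of p i t] p by (simp add: mult.assoc)
  qed
  have S1: "(S1 has_real_derivative S2 t) (at t)" for t
    unfolding S1_def[abs_def] S2_def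
  proof (rule DERIV_sum)
    fix i
    have "((\<lambda>t. sgn (d i + t * y i) * \<bar>d i + t * y i\<bar> powr (p - 1)) has_real_derivative
        (p - 1) * \<bar>d i + t * y i\<bar> powr (p - 2) * y i) (at t)"
      using DERIV_chain2[OF has_real_derivative_sgn_abs_powr lin, of "p - 1" i t] p by simp
    then show "((\<lambda>t. p * (sgn (d i + t * y i) * \<bar>d i + t * y i\<bar> powr (p - 1)) * y i)
        has_real_derivative p * ((p - 1) * \<bar>d i + t * y i\<bar> powr (p - 2) * y i) * y i) (at t)"
      by (intro DERIV_cmult_right DERIV_cmult)
  qed
  \<comment> \<open>\<open>F m\<close> is the \<open>m\<close>-th derivative of \<open>S\<^bsup>2/p\<^esup>\<close>, for \<open>m \<le> 2\<close>.\<close>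
  define F where "F m t = (if m = (0::nat) then S t powr (2 / p)
      else if m = 1 then 2 / p * S t powr (2 / p - 1) * S1 t
      else 2 / p * ((2 / p - 1) * S t powr (2 / p - 1 - 1) * S1 t * S1 t + S t powr (2 / p - 1) * S2 t))"
    for m t
  have D0: "(F 0 has_real_derivative F 1 t) (at t)" if "0 \<le> t" "t \<le> 1" for t
    using DERIV_fun_powr[OF S Spos, of t "2 / p"] that by (simp add: F_def[abs_def])
  have D1: "(F 1 has_real_derivative F 2 t) (at t)" if "0 \<le> t" "t \<le> 1" for t
    using DERIV_mult[OF DERIV_cmult[OF DERIV_fun_powr[OF S Spos, of t "2 / p - 1"], of "2 / p"] S1] that
    by (simp add: F_def[abs_def] algebra_simps)
  have "\<forall>m t. m < 2 \<and> 0 \<le> t \<and> t \<le> 1 \<longrightarrow> DERIV (F m) t :> F (Suc m) t"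
    using D0 D1 by (auto simp: less_2_cases_iff simp flip: numeral_2_eq_2)
  from Maclaurin2[of 1 F "F 0" 2, OF _ refl this]
  obtain t where t: "0 < t" "t \<le> 1" and "F 0 1 = F 0 0 + F 1 0 + F 2 t / 2"
    by (auto simp: numeral_2_eq_2)
  moreover have "F 0 1 = (lp_norm n p (d + y))\<^sup>2"
    by (simp add: F_def S_def lp_norm_sq)
  moreover have "F 0 0 = (lp_norm n p d)\<^sup>2"
    by (simp add: F_def S_def lp_norm_sq)
  moreover have "F 1 0 = 2 * inner_n n y (duality_map n p d)"
  proof -
    have e: "lp_norm n p d powr (2 - p) = S 0 powr (2 / p - 1)"
      using p by (simp add: lp_norm_def S_def powr_powr diff_divide_distrib)
    show ?thesis
      using p by (simp add: F_def S1_def inner_n_def duality_map_def e sum_distrib_left mult_ac)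
  qed
  moreover have "F 2 t \<le> 2 * (p - 1) * (lp_norm n p y)\<^sup>2"
  proof -
    have St: "0 < S t" using Spos t by simp
    have "2 / p - 1 \<le> 0" using p by simp
    then have "(2 / p - 1) * (S t powr (2 / p - 1 - 1) * (S1 t * S1 t)) \<le> 0"
      by (intro mult_nonpos_nonneg) auto
    then have "2 / p * ((2 / p - 1) * (S t powr (2 / p - 1 - 1) * (S1 t * S1 t))
        + S t powr (2 / p - 1) * S2 t) \<le> 2 / p * (S t powr (2 / p - 1) * S2 t)"
      using p by (intro mult_left_mono) auto
    then have "F 2 t \<le> 2 / p * (S t powr (2 / p - 1) * S2 t)"
      by (simp add: F_def mult.assoc)
    also have "S2 t = p * (p - 1) * (\<Sum>i<n. \<bar>d i + t * y i\<bar> powr (p - 2) * (y i)\<^sup>2)"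
      by (simp add: S2_def sum_distrib_left power2_eq_square mult_ac)
    also have "(\<Sum>i<n. \<bar>d i + t * y i\<bar> powr (p - 2) * (y i)\<^sup>2)
        = (\<Sum>i<n. (\<bar>d i + t * y i\<bar> powr p) powr (1 - 2 / p) * (\<bar>y i\<bar> powr p) powr (2 / p))"
    proof (intro sum.cong refl arg_cong2[where f = "(*)"])
      fix i
      show "\<bar>d i + t * y i\<bar> powr (p - 2) = (\<bar>d i + t * y i\<bar> powr p) powr (1 - 2 / p)"
        using p by (simp add: powr_powr algebra_simps)
      show "(y i)\<^sup>2 = (\<bar>y i\<bar> powr p) powr (2 / p)"
        using p by (simp add: powr_powr)
    qed
    also have "2 / p * (S t powr (2 / p - 1) * (p * (p - 1) * \<dots>))
        \<le> 2 / p * (S t powr (2 / p - 1) * (p * (p - 1) *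
            (S t powr (1 - 2 / p) * (\<Sum>i<n. \<bar>y i\<bar> powr p) powr (2 / p))))"
      unfolding S_def using p by (intro mult_left_mono Hoelder_sum_powr) auto
    also have "\<dots> = 2 * (p - 1) * (S t powr (2 / p - 1) * S t powr (1 - 2 / p)) * (lp_norm n p y)\<^sup>2"
      using p by (simp add: lp_norm_sq)
    also have "S t powr (2 / p - 1) * S t powr (1 - 2 / p) = 1"
      using St by (simp flip: powr_add)
    finally show ?thesis by (simp only: mult_1_right)
  qed
  ultimately show ?thesis by linarith
qed

text \<open>
  The function \<open>\<parallel>\<cdot>\<parallel>\<^sub>p\<^sup>2 / 2\<close> is \<open>(p - 1)\<close>-smooth with respect to \<open>\<parallel>\<cdot>\<parallel>\<^sub>p\<close>, that is, \<open>\<ell>\<^sub>p\<close> is 2-uniformly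
  smooth with a constant that does not depend on the dimension. If the segment from \<open>d\<close> to
  \<open>d + y\<close> meets the origin, then \<open>d = - t y\<close> and both sides are multiples of \<open>\<parallel>y\<parallel>\<^sub>p\<^sup>2\<close>.
\<close>

lemma lp_norm_sq_add_le:
  assumes p: "p \<ge> 2"
  shows "(lp_norm n p (d + y))\<^sup>2
    \<le> (lp_norm n p d)\<^sup>2 + 2 * inner_n n y (duality_map n p d) + (p - 1) * (lp_norm n p y)\<^sup>2"
proof (cases "p = 2")
  case True
  have sq: "(lp_norm n 2 z)\<^sup>2 = (\<Sum>i<n. (z i)\<^sup>2)" for z
    by (simp add: lp_norm_sq sum_nonneg)
  have "duality_map n 2 d i = d i" if "i < n" for i
    using that lp_norm_eq_0_iff[of n 2 d] by (auto simp: duality_map_def sgn_if)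
  then have "inner_n n y (duality_map n 2 d) = (\<Sum>i<n. y i * d i)"
    by (simp add: inner_n_def)
  then show ?thesis
    unfolding True sq
    by (simp add: power2_sum sum.distrib sum_distrib_left mult_ac)
next
  case False
  with p have p2: "p > 2" by simp
  show ?thesis
  proof (cases "\<exists>t. 0 \<le> t \<and> t \<le> 1 \<and> (\<forall>i<n. d i + t * y i = 0)")
    case True
    then obtain t where t: "0 \<le> t" "t \<le> 1" and "\<forall>i<n. d i + t * y i = 0" by blast
    then have d: "d i = - t * y i" if "i < n" for i using that by force
    have Nd: "lp_norm n p d = t * lp_norm n p y"
      using lp_norm_scaleR[of p n "- t" y] lp_norm_cong[of n d "(- t) *\<^sub>R y" p] d t p by simp
    have "lp_norm n p (d + y) = lp_norm n p ((1 - t) *\<^sub>R y)"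
      using d by (intro lp_norm_cong) (simp add: algebra_simps)
    then have Ndy: "lp_norm n p (d + y) = (1 - t) * lp_norm n p y"
      using lp_norm_scaleR[of p n "1 - t" y] t p by simp
    have inner: "inner_n n y (duality_map n p d) = - t * (lp_norm n p y)\<^sup>2"
    proof (cases "t = 0")
      case True
      then show ?thesis using d by (simp add: inner_n_def duality_map_def)
    next
      case False
      have "- t * inner_n n y (duality_map n p d) = inner_n n d (duality_map n p d)"
        unfolding inner_n_scaleR_left[symmetric] by (rule inner_n_cong_left) (simp add: d)
      also have "\<dots> = t * (t * (lp_norm n p y)\<^sup>2)"
        using inner_duality_map_self[of p n d] p by (simp add: Nd power2_eq_square)
      finally have "t * (inner_n n y (duality_map n p d) + t * (lp_norm n p y)\<^sup>2) = 0"
        by (simp add: algebra_simps)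
      with False show ?thesis by simp
    qed
    have "(1 - t)\<^sup>2 * (lp_norm n p y)\<^sup>2 \<le> (t\<^sup>2 - 2 * t + (p - 1)) * (lp_norm n p y)\<^sup>2"
      using p by (intro mult_right_mono) (auto simp: power2_diff)
    then show ?thesis
      unfolding Nd Ndy inner power_mult_distrib by (simp add: left_diff_distrib distrib_right)
  next
    case False
    then show ?thesis using p2 by (intro lp_norm_sq_add_le_segment) auto
  qed
qed

section \<open>A Frank-Wolfe step\<close>

lemma inner_gradient_half_sq_dist:
  assumes "p \<ge> 2" "x \<in> topspace (Euclidean_space n)" "xstar \<in> topspace (Euclidean_space n)"
  shows "inner_n n y (gradient n (half_sq_dist n p xstar) x) = inner_n n y (duality_map n p (x - xstar))"
  unfolding inner_n_def
  by (intro sum.cong refl) (auto simp: gradient_half_sq_dist[OF assms] duality_map_def)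

text \<open>
  The minimizer \<open>v\<close> competes with the midpoint of \<open>x\<close> and \<open>v\<close>, pushed in the direction \<open>z\<close>. The
  midpoint alone already loses half of the gap against \<open>v\<close>; the push has to be paid by the other
  half.
\<close>

lemma uniformly_convex_gap:
  assumes uc: "uniformly_convex n N \<alpha> q C" and xv: "x \<in> C" "v \<in> C"
    and lmo: "\<And>u. u \<in> C \<Longrightarrow> inner_n n v G \<le> inner_n n u G"
    and z: "z \<in> topspace (Euclidean_space n)" "N z = 1"
  shows "\<alpha> / 2 * N (x - v) powr q * (- inner_n n z G) \<le> inner_n n (x - v) G"
proof -
  define w where "w = (1 - 1/2) *\<^sub>R x + (1/2) *\<^sub>R v + ((1 - 1/2) * (1/2) * \<alpha> * N (x - v) powr q) *\<^sub>R z"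
  have "(1/2::real) \<in> {0..1}" by simp
  with uc xv z have "w \<in> C"
    unfolding uniformly_convex_def w_def by blast
  then have "inner_n n v G \<le> inner_n n w G" by (rule lmo)
  then show ?thesis
    by (simp add: w_def inner_n_add_left inner_n_scaleR_left inner_n_diff_left)
qed

text \<open>
  If the step size were capped at \<open>1\<close>, then \<open>(p - 1) \<parallel>x - v\<parallel>\<^sub>p\<^sup>2 \<le> g\<close>, and smoothness would bound the
  new squared distance by \<open>\<parallel>x - x\<^sup>*\<parallel>\<^sub>p\<^sup>2 - 2 g + g \<le> 0\<close>. So as long as \<open>x\<^sup>*\<close> is not hit exactly, the
  step is the minimizer of the quadratic upper bound, and the decrease is the one of that minimizer.
\<close>

lemma short_step_decrease:
  assumes p: "p \<ge> 2" and s: "0 < lp_norm n p (x - v)"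
    and g: "g = inner_n n (x - v) (duality_map n p (x - xstar))"
    and dg: "(lp_norm n p (x - xstar))\<^sup>2 \<le> g"
    and \<gamma>: "\<gamma> = min (g / ((p - 1) * (lp_norm n p (x - v))\<^sup>2)) 1"
    and nz: "lp_norm n p (x + \<gamma> *\<^sub>R (v - x) - xstar) \<noteq> 0"
  shows "(lp_norm n p (x + \<gamma> *\<^sub>R (v - x) - xstar))\<^sup>2
    \<le> (lp_norm n p (x - xstar))\<^sup>2 - g\<^sup>2 / ((p - 1) * (lp_norm n p (x - v))\<^sup>2)"
proof -
  define M where "M = (p - 1) * (lp_norm n p (x - v))\<^sup>2"
  define d' where "d' = lp_norm n p (x + \<gamma> *\<^sub>R (v - x) - xstar)"
  have M: "M > 0" using p s by (simp add: M_def)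
  have g0: "0 \<le> g" using dg by (meson order_trans zero_le_power2)
  have split: "x + \<gamma> *\<^sub>R (v - x) - xstar = (x - xstar) + (- \<gamma>) *\<^sub>R (x - v)"
    by (simp add: fun_eq_iff algebra_simps)
  have "d'\<^sup>2 \<le> (lp_norm n p (x - xstar))\<^sup>2
      + 2 * inner_n n ((- \<gamma>) *\<^sub>R (x - v)) (duality_map n p (x - xstar))
      + (p - 1) * (lp_norm n p ((- \<gamma>) *\<^sub>R (x - v)))\<^sup>2"
    unfolding d'_def split by (rule lp_norm_sq_add_le[OF p])
  also have "\<dots> = (lp_norm n p (x - xstar))\<^sup>2 - 2 * \<gamma> * g + \<gamma>\<^sup>2 * M"
    using p by (simp add: inner_n_scaleR_left lp_norm_scaleR g M_def power_mult_distrib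
        del: scaleR_minus_left)
  finally have dec: "d'\<^sup>2 \<le> (lp_norm n p (x - xstar))\<^sup>2 - 2 * \<gamma> * g + \<gamma>\<^sup>2 * M" .
  have "g / M < 1"
  proof (rule ccontr)
    assume "\<not> g / M < 1"
    then have "\<gamma> = 1" "M \<le> g" using M by (auto simp: \<gamma> M_def[symmetric] field_simps)
    with dec have "d'\<^sup>2 \<le> (lp_norm n p (x - xstar))\<^sup>2 - 2 * g + M" by simp
    with dg \<open>M \<le> g\<close> have "d'\<^sup>2 \<le> 0" by linarith
    with nz show False by (simp add: d'_def)
  qed
  then have \<gamma>M: "\<gamma> = g / M" by (simp add: \<gamma> M_def[symmetric])
  have "- 2 * \<gamma> * g + \<gamma>\<^sup>2 * M = - (g\<^sup>2 / M)"
    unfolding \<gamma>M using M by (simp add: power2_eq_square)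
  with dec show ?thesis by (simp add: d'_def M_def)
qed

text \<open>
  The second bound on \<open>g\<close> limits the step length: \<open>s\<^sup>2 \<le> (g / (a d))\<^bsup>2/q\<^esup>\<close>. Then
  \<open>g\<^sup>2 / s\<^sup>2 \<ge> g\<^bsup>2 - 2/q\<^esup> (a d)\<^bsup>2/q\<^esup>\<close> has a nonnegative exponent of \<open>g\<close>, and the first bound applies.
\<close>

lemma gap_sq_div_step_sq_ge:
  fixes a d g q s :: real
  assumes pos: "0 < a" "0 < d" "0 < s" and q: "q \<ge> 1"
    and dg: "d\<^sup>2 \<le> g" and sg: "a * s powr q * d \<le> g"
  shows "a powr (2 / q) * (d\<^sup>2) powr (2 - 1 / q) \<le> g\<^sup>2 / s\<^sup>2"
proof -
  have g: "0 < g" using dg pos by (smt (verit) zero_less_power2)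
  have "s powr q \<le> g / (a * d)"
    using sg pos by (simp add: field_simps)
  then have "(s powr q) powr (2 / q) \<le> (g / (a * d)) powr (2 / q)"
    using q by (intro powr_mono2) auto
  then have "s\<^sup>2 \<le> (g / (a * d)) powr (2 / q)"
    using q pos by (simp add: powr_powr)
  then have "s\<^sup>2 * (a * d) powr (2 / q) \<le> g powr (2 / q)"
    using pos g by (simp add: powr_divide field_simps)
  then have "(a * d) powr (2 / q) * g powr (2 - 2 / q) * s\<^sup>2 \<le> g powr (2 / q) * g powr (2 - 2 / q)"
    using mult_right_mono[of _ _ "g powr (2 - 2 / q)"] by (fastforce simp: mult_ac)
  also have "\<dots> = g\<^sup>2"
    using g by (simp flip: powr_add)
  finally have *: "(a * d) powr (2 / q) * g powr (2 - 2 / q) \<le> g\<^sup>2 / s\<^sup>2"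
    using pos by (simp add: field_simps)
  have "d powr (2 / q) = (d\<^sup>2) powr (1 / q)"
    using pos by (simp add: powr_powr flip: powr_numeral)
  then have "a powr (2 / q) * (d\<^sup>2) powr (2 - 1 / q)
      = (a * d) powr (2 / q) * (d\<^sup>2) powr (2 - 2 / q)"
    using pos by (simp add: powr_mult flip: powr_add)
  also have "\<dots> \<le> (a * d) powr (2 / q) * g powr (2 - 2 / q)"
    using dg q by (intro mult_left_mono powr_mono2) (auto simp: field_simps)
  also note *
  finally show ?thesis .
qed

section \<open>Convergence rate and cardinality\<close>

text \<open>
  The discrete counterpart of \<open>u' = - \<kappa> u\<^bsup>1 + b\<^esup>\<close>, along which \<open>u\<^bsup>-b\<^esup>\<close> has the constant derivative
  \<open>b \<kappa>\<close>. With \<open>y = \<kappa> u\<^sup>b\<close> one has \<open>u' \<le> u (1 - y) \<le> u exp (- y)\<close>, and \<open>exp (b y) \<ge> 1 + b y\<close>.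
\<close>

lemma powr_neg_increment:
  fixes u u' \<kappa> b :: real
  assumes pos: "0 < u'" "0 < u" "0 \<le> b" and dec: "u' \<le> u - \<kappa> * u powr (1 + b)"
  shows "u powr (- b) + b * \<kappa> \<le> u' powr (- b)"
proof -
  define y where "y = \<kappa> * u powr b"
  have "u' \<le> u * (1 - y)"
    using dec pos by (simp add: y_def powr_add algebra_simps)
  also have "\<dots> \<le> u * exp (- y)"
    using pos exp_ge_add_one_self[of "- y"] by (intro mult_left_mono) auto
  finally have "(u * exp (- y)) powr (- b) \<le> u' powr (- b)"
    using pos by (intro powr_mono2') auto
  moreover have "(u * exp (- y)) powr (- b) = u powr (- b) * exp (b * y)"
    using pos by (simp add: powr_mult exp_powr_real mult.commute)
  moreover have "u powr (- b) * (1 + b * y) \<le> u powr (- b) * exp (b * y)"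
    by (intro mult_left_mono exp_ge_add_one_self) auto
  moreover have "u powr (- b) * (1 + b * y) = u powr (- b) + b * \<kappa>"
    using pos by (simp add: y_def powr_minus field_simps)
  ultimately show ?thesis by simp
qed

lemma powr_neg_linear_growth:
  fixes u :: "nat \<Rightarrow> real"
  assumes b: "0 \<le> b" and pos: "\<And>t. t \<le> T \<Longrightarrow> 0 < u t"
    and dec: "\<And>t. t < T \<Longrightarrow> u (Suc t) \<le> u t - \<kappa> * u t powr (1 + b)"
  shows "t \<le> T \<Longrightarrow> real t * (b * \<kappa>) \<le> u t powr (- b)"
proof (induction t)
  case (Suc t)
  then have "u t powr (- b) + b * \<kappa> \<le> u (Suc t) powr (- b)"
    using pos dec b by (intro powr_neg_increment) auto
  with Suc show ?case by (simp add: distrib_right)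
qed simp

lemma fw_cardinality_le: "fw_cardinality x0 v \<gamma> t \<le> Suc t"
proof -
  have "fw_weight x0 v \<gamma> t u = 0" if "u \<notin> insert x0 (v ` {..<t})" for u
    using that by (induction t) (auto simp: lessThan_Suc)
  then have "{u. fw_weight x0 v \<gamma> t u > 0} \<subseteq> insert x0 (v ` {..<t})"
    by force
  then have "fw_cardinality x0 v \<gamma> t \<le> card (insert x0 (v ` {..<t}))"
    unfolding fw_cardinality_def by (intro card_mono) auto
  also have "\<dots> \<le> Suc (card (v ` {..<t}))"
    by (rule card_insert_le_m1) auto
  also have "\<dots> \<le> Suc t"
    using card_image_le[of "{..<t}" v] by simp
  finally show ?thesis .
qed

lemma frank_wolfe_iterates_in:
  assumes run: "frank_wolfe_run n C f x v \<gamma>" and "convex C"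
  shows "x t \<in> C"
proof (induction t)
  case 0
  then show ?case using run by (auto simp: frank_wolfe_run_def extreme_point_of_def)
next
  case (Suc t)
  have "v t \<in> C" "0 \<le> \<gamma> t" "\<gamma> t \<le> 1" "x (Suc t) = x t + \<gamma> t *\<^sub>R (v t - x t)"
    using run by (auto simp: frank_wolfe_run_def extreme_point_of_def)
  moreover have "x t + \<gamma> t *\<^sub>R (v t - x t) = (1 - \<gamma> t) *\<^sub>R x t + \<gamma> t *\<^sub>R v t"
    by (simp add: fun_eq_iff algebra_simps)
  moreover have "(1 - \<gamma> t) *\<^sub>R x t + \<gamma> t *\<^sub>R v t \<in> C"
    using Suc \<open>convex C\<close> calculation(1-3) unfolding convex_alt by blast
  ultimately show ?case by (simp only:)
qed

text \<open>
  The direction for \<open>uniformly_convex_gap\<close> is \<open>z = - (x t - x\<^sup>*) / \<parallel>x t - x\<^sup>*\<parallel>\<^sub>p\<close>. It attains the dual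
  norm of the gradient up to sign, \<open>\<langle>z, \<nabla>f(x t)\<rangle> = - \<parallel>x t - x\<^sup>*\<parallel>\<^sub>p\<close>, because the gradient is the image
  of \<open>x t - x\<^sup>*\<close> under the duality map.
\<close>

lemma closed_loop_sq_dist_recursion:
  assumes p: "p \<ge> 2" and q: "q \<ge> 1"
    and CE: "C \<subseteq> topspace (Euclidean_space n)" and "convex C"
    and uc: "uniformly_convex n (lp_norm n p) \<alpha> q C" and xs: "xstar \<in> C"
    and run: "frank_wolfe_run n C (half_sq_dist n p xstar) x v \<gamma>"
    and cl: "closed_loop n p (half_sq_dist n p xstar) x v \<gamma>"
    and d: "0 < lp_norm n p (x t - xstar)" and d': "0 < lp_norm n p (x (Suc t) - xstar)"
  shows "(lp_norm n p (x (Suc t) - xstar))\<^sup>2 \<le> (lp_norm n p (x t - xstar))\<^sup>2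
    - (\<alpha> / 2) powr (2 / q) / (p - 1) * (lp_norm n p (x t - xstar))\<^sup>2 powr (1 + (q - 1) / q)"
proof -
  define G where "G = gradient n (half_sq_dist n p xstar) (x t)"
  define e where "e = x t - xstar"
  define g where "g = inner_n n (x t - v t) G"
  have inC: "x t \<in> C" "v t \<in> C"
    using frank_wolfe_iterates_in[OF run \<open>convex C\<close>] run
    by (auto simp: frank_wolfe_run_def extreme_point_of_def)
  then have inE: "x t \<in> topspace (Euclidean_space n)" "v t \<in> topspace (Euclidean_space n)"
    "xstar \<in> topspace (Euclidean_space n)" using CE xs by auto
  have G: "inner_n n y G = inner_n n y (duality_map n p e)" for y
    unfolding G_def e_def by (rule inner_gradient_half_sq_dist[OF p inE(1,3)])
  have eG: "inner_n n e G = (lp_norm n p e)\<^sup>2"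
    using p by (simp add: G inner_duality_map_self)
  have lmo: "inner_n n (v t) G \<le> inner_n n u G" if "u \<in> C" for u
    using run that unfolding frank_wolfe_run_def is_arg_min_linorder G_def by blast
  have dg: "(lp_norm n p e)\<^sup>2 \<le> g"
    using lmo[OF xs] eG by (simp add: g_def e_def inner_n_diff_left)
  have "v t \<noteq> x t"
  proof
    assume "v t = x t"
    then have "g = 0" by (simp add: g_def inner_n_def)
    with dg d show False by (simp add: e_def)
  qed
  then have s: "0 < lp_norm n p (x t - v t)"
    using inE by (intro lp_norm_pos) auto
  have \<gamma>: "\<gamma> t = min (g / ((p - 1) * (lp_norm n p (x t - v t))\<^sup>2)) 1"
    using cl \<open>v t \<noteq> x t\<close> by (simp add: closed_loop_def g_def G_def)
  have x': "x (Suc t) = x t + \<gamma> t *\<^sub>R (v t - x t)"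
    using run by (simp add: frank_wolfe_run_def)
  have dec: "(lp_norm n p (x (Suc t) - xstar))\<^sup>2
      \<le> (lp_norm n p e)\<^sup>2 - g\<^sup>2 / ((p - 1) * (lp_norm n p (x t - v t))\<^sup>2)"
    unfolding x' e_def
  proof (rule short_step_decrease[OF p s _ _ \<gamma>])
    show "g = inner_n n (x t - v t) (duality_map n p (x t - xstar))"
      using G by (simp add: g_def e_def)
    show "(lp_norm n p (x t - xstar))\<^sup>2 \<le> g" using dg by (simp add: e_def)
    show "lp_norm n p (x t + \<gamma> t *\<^sub>R (v t - x t) - xstar) \<noteq> 0" using d' by (simp add: x')
  qed
  define z where "z = (- (1 / lp_norm n p e)) *\<^sub>R e"
  have "z \<in> topspace (Euclidean_space n)"
    using inE by (simp add: z_def e_def topspace_Euclidean_space)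
  moreover have "lp_norm n p z = 1"
    unfolding z_def using p d by (subst lp_norm_scaleR) (auto simp: e_def)
  ultimately have "\<alpha> / 2 * lp_norm n p (x t - v t) powr q * (- inner_n n z G) \<le> g"
    unfolding g_def by (intro uniformly_convex_gap[OF uc inC lmo]) auto
  moreover have "- inner_n n z G = lp_norm n p e"
    unfolding z_def inner_n_scaleR_left eG by (simp add: power2_eq_square)
  ultimately have sg: "\<alpha> / 2 * lp_norm n p (x t - v t) powr q * lp_norm n p e \<le> g" by simp
  have "0 < \<alpha>" using uc by (simp add: uniformly_convex_def)
  then have "(\<alpha> / 2) powr (2 / q) * ((lp_norm n p e)\<^sup>2) powr (2 - 1 / q) \<le> g\<^sup>2 / (lp_norm n p (x t - v t))\<^sup>2"
    using s d q dg sg by (intro gap_sq_div_step_sq_ge) (auto simp: e_def)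
  then have "(\<alpha> / 2) powr (2 / q) * ((lp_norm n p e)\<^sup>2) powr (2 - 1 / q) / (p - 1)
      \<le> g\<^sup>2 / (lp_norm n p (x t - v t))\<^sup>2 / (p - 1)"
    using p by (intro divide_right_mono) auto
  moreover have "2 - 1 / q = 1 + (q - 1) / q" using q by (simp add: field_simps)
  ultimately show ?thesis using dec by (simp add: e_def mult.commute)
qed

text \<open>
  If \<open>\<parallel>x t - x\<^sup>*\<parallel>\<^sub>p > \<epsilon>\<close> for all \<open>t \<le> T\<close>, the recursion yields \<open>T b \<kappa> < \<epsilon>\<^bsup>-2b\<^esup>\<close>. Since \<open>q \<ge> 2\<close>, both
  \<open>b \<ge> 1/2\<close> and \<open>2\<^bsup>2/q\<^esup> \<le> 2\<close>, which together account for the factor \<open>4\<close>.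
\<close>

lemma closed_loop_early_iterate:
  assumes p: "p \<ge> 2" and q: "q \<ge> 2" and \<epsilon>: "\<epsilon> > 0"
    and CE: "C \<subseteq> topspace (Euclidean_space n)" and "convex C"
    and uc: "uniformly_convex n (lp_norm n p) \<alpha> q C" and xs: "xstar \<in> C"
    and run: "frank_wolfe_run n C (half_sq_dist n p xstar) x v \<gamma>"
    and cl: "closed_loop n p (half_sq_dist n p xstar) x v \<gamma>"
    and T: "4 * (p / \<alpha> powr (2 / q) / \<epsilon> powr (2 * (q - 1) / q)) \<le> real T"
  shows "\<exists>t\<le>T. lp_norm n p (x t - xstar) \<le> \<epsilon>"
proof (rule ccontr)
  assume "\<not> (\<exists>t\<le>T. lp_norm n p (x t - xstar) \<le> \<epsilon>)"
  then have far: "\<epsilon> < lp_norm n p (x t - xstar)" if "t \<le> T" for t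
    using that by (meson not_le)
  define u where "u t = (lp_norm n p (x t - xstar))\<^sup>2" for t
  define b where "b = (q - 1) / q"
  define \<kappa> where "\<kappa> = (\<alpha> / 2) powr (2 / q) / (p - 1)"
  have \<alpha>: "\<alpha> > 0" using uc by (simp add: uniformly_convex_def)
  have b: "1 / 2 \<le> b" using q by (simp add: b_def field_simps)
  have "real T * (b * \<kappa>) \<le> u T powr (- b)"
  proof (rule powr_neg_linear_growth[where T = T])
    show "0 < u t" if "t \<le> T" for t using far[OF that] \<epsilon> by (simp add: u_def)
    show "u (Suc t) \<le> u t - \<kappa> * u t powr (1 + b)" if "t < T" for t
      unfolding u_def \<kappa>_def b_def
      using far[of t] far[of "Suc t"] that \<epsilon> q
      by (intro closed_loop_sq_dist_recursion[OF p _ CE \<open>convex C\<close> uc xs run cl]) auto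
  qed (use b in auto)
  also have "u T powr (- b) < (\<epsilon>\<^sup>2) powr (- b)"
  proof (rule powr_less_mono2_neg)
    show "\<epsilon>\<^sup>2 < u T" unfolding u_def using far[of T] \<epsilon> by (intro power_strict_mono) auto
  qed (use b \<epsilon> in auto)
  also have "(\<epsilon>\<^sup>2) powr (- b) = 1 / \<epsilon> powr (2 * (q - 1) / q)"
    using \<epsilon> by (simp add: b_def powr_powr powr_minus_divide flip: powr_numeral)
  finally have "real T * (b * \<kappa>) < 1 / \<epsilon> powr (2 * (q - 1) / q)" .
  moreover have "\<alpha> powr (2 / q) / (4 * p) \<le> b * \<kappa>"
  proof -
    have "2 powr (2 / q) \<le> (2::real) powr 1" using q by (intro powr_mono) auto
    then have "\<alpha> powr (2 / q) / (4 * p) \<le> \<alpha> powr (2 / q) / (2 * 2 powr (2 / q) * (p - 1))"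
      using p by (intro divide_left_mono mult_mono) auto
    also have "\<dots> = 1 / 2 * \<kappa>"
      using \<alpha> by (simp add: \<kappa>_def powr_divide)
    also have "\<dots> \<le> b * \<kappa>"
      using b p by (intro mult_right_mono) (auto simp: \<kappa>_def)
    finally show ?thesis .
  qed
  then have "real T * (\<alpha> powr (2 / q) / (4 * p)) \<le> real T * (b * \<kappa>)"
    by (intro mult_left_mono) auto
  ultimately have "real T * (\<alpha> powr (2 / q) / (4 * p)) < 1 / \<epsilon> powr (2 * (q - 1) / q)" by linarith
  then have "real T < 4 * (p / \<alpha> powr (2 / q) / \<epsilon> powr (2 * (q - 1) / q))"
    using \<alpha> p \<epsilon> by (simp add: field_simps)
  with T show False by simp
qed

theorem corollary5p5:
  shows "\<exists>K::real. K > 0 \<and>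
    (\<forall>(n::nat) (p::real) (\<alpha>::real) (q::real) (\<epsilon>::real) (C::(nat \<Rightarrow> real) set) (xstar::nat \<Rightarrow> real)
       (x::nat \<Rightarrow> nat \<Rightarrow> real) (v::nat \<Rightarrow> nat \<Rightarrow> real) (\<gamma>::nat \<Rightarrow> real).
       p \<ge> 2 \<and> \<alpha> > 0 \<and> q \<ge> 2 \<and> \<epsilon> > 0 \<and>
       C \<noteq> {} \<and> compactin (Euclidean_space n) C \<and> convex C \<and>
       uniformly_convex n (lp_norm n p) \<alpha> q C \<and>
       xstar \<in> C \<and>
       frank_wolfe_run n C (half_sq_dist n p xstar) x v \<gamma> \<and>
       closed_loop n p (half_sq_dist n p xstar) x v \<gamma> \<longrightarrow>
       (let D = lp_diameter n p C;
            B = ((p * D\<^sup>2) powr ((q - 1) / q) + p / \<alpha> powr (2 / q)) / \<epsilon> powr (2 * (q - 1) / q)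
        in \<exists>t. x t \<in> C \<and> lp_norm n p (x t - xstar) \<le> \<epsilon> \<and>
               real (fw_cardinality (x 0) v \<gamma> t) \<le> K * max 1 B))"
proof (rule exI[of _ 6], intro conjI allI impI)
  \<comment> \<open>At most \<open>\<lceil>4 B\<rceil> \<le> 4 B + 1\<close> steps, and one more vertex for the start: \<open>4 B + 2 \<le> 6 max {1, B}\<close>.\<close>
  show "(0::real) < 6" by simp
next
  fix n :: nat and p \<alpha> q \<epsilon> :: real and C :: "(nat \<Rightarrow> real) set" and xstar :: "nat \<Rightarrow> real"
    and x v :: "nat \<Rightarrow> nat \<Rightarrow> real" and \<gamma> :: "nat \<Rightarrow> real"
  assume asm: "p \<ge> 2 \<and> \<alpha> > 0 \<and> q \<ge> 2 \<and> \<epsilon> > 0 \<and>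
       C \<noteq> {} \<and> compactin (Euclidean_space n) C \<and> convex C \<and>
       uniformly_convex n (lp_norm n p) \<alpha> q C \<and>
       xstar \<in> C \<and>
       frank_wolfe_run n C (half_sq_dist n p xstar) x v \<gamma> \<and>
       closed_loop n p (half_sq_dist n p xstar) x v \<gamma>"
  define B where "B = ((p * (lp_diameter n p C)\<^sup>2) powr ((q - 1) / q) + p / \<alpha> powr (2 / q))
    / \<epsilon> powr (2 * (q - 1) / q)"
  define T where "T = nat \<lceil>4 * B\<rceil>"
  have "p / \<alpha> powr (2 / q) / \<epsilon> powr (2 * (q - 1) / q) \<le> B"
    unfolding B_def by (intro divide_right_mono) auto
  moreover have "0 \<le> B"
    unfolding B_def using asm by (intro divide_nonneg_nonneg add_nonneg_nonneg) auto
  ultimately have T: "4 * (p / \<alpha> powr (2 / q) / \<epsilon> powr (2 * (q - 1) / q)) \<le> real T"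
      "real T \<le> 4 * B + 1"
    unfolding T_def by linarith+
  have "C \<subseteq> topspace (Euclidean_space n)"
    using asm compactin_subset_topspace by blast
  then obtain t where t: "t \<le> T" "lp_norm n p (x t - xstar) \<le> \<epsilon>"
    using closed_loop_early_iterate[OF _ _ _ _ _ _ _ _ _ T(1), of C n xstar x v \<gamma>] asm by blast
  have "real (fw_cardinality (x 0) v \<gamma> t) \<le> real T + 1"
    using fw_cardinality_le[of "x 0" v \<gamma> t] t(1) by linarith
  also have "\<dots> \<le> 6 * max 1 B" using T(2) by linarith
  finally have "\<exists>t. x t \<in> C \<and> lp_norm n p (x t - xstar) \<le> \<epsilon> \<and>
      real (fw_cardinality (x 0) v \<gamma> t) \<le> 6 * max 1 B"
    using t(2) frank_wolfe_iterates_in[of n C _ x v \<gamma> t] asm by blast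
  then show "let D = lp_diameter n p C;
            B = ((p * D\<^sup>2) powr ((q - 1) / q) + p / \<alpha> powr (2 / q)) / \<epsilon> powr (2 * (q - 1) / q)
        in \<exists>t. x t \<in> C \<and> lp_norm n p (x t - xstar) \<le> \<epsilon> \<and>
               real (fw_cardinality (x 0) v \<gamma> t) \<le> 6 * max 1 B"
    unfolding Let_def B_def .
qed

end
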